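(* Let $G_0=(V,E_0,\mathbf{w}_0)$ be an initial finite weighted graph. Fix any real number $A>1$ satisfying $$A>\max_{e\in E_0}\left(\frac{w_{0,e}}{\min_{e'\in E_0^e}w_{0,e'}}\right),$$ where $E_0^e$ denotes the set of edges of the connected component of $G_0$ containing the edge $e$. Let $(t_k)_{k\in\mathbb{N}}$ be a strictly increasing sequence of positive numbers satisfying $t_k\to+\infty$ as $k\to+\infty$. Suppose $w_e(t_k)$ and $c_{k,e}$ are given by the discrete piecewise-linear Ricci curvature flow with $A$-surgeries with initial graph $G_0$. Then there exists $\ell\in\mathbb{N}$ such that for $k\geq\ell$, every connected component $G'(t_k)=(V',E',\mathbf{w}(t_k))$ of the graph $G(t_k)=(V,E_{\ell-1},\mathbf{w}(t_k))$ satisfies: 1. (Edge weight ratios) for all $e,e'\in E'$, $$\frac{w_e(t_k)}{w_{e'}(t_k)}\equiv\frac{w_e(t_\ell)}{w_{e'}(t_\ell)},\quad\forall k\geq\ell;$$ 2. (Constant Ricci curvature) if $\kappa$, the Ricci curvature being used, is $\gamma$-homogeneous for some real number $\gamma$, then there exists a constant $\Theta_k=\Theta_k(E',\gamma)$ such that $\kappa_e(t_k)=\Theta_k$ for any edge $e\in E'$.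
   Context: A finite weighted graph $G=(V,E,\mathbf{w})$ has a finite vertex set $V$, a finite edge set $E$ and positive edge weights $\mathbf{w}=(w_e)_{e\in E}$. Ricci curvature: $\kappa$ denotes any Ricci curvature on finite weighted graphs, fixed throughout; it assigns to each edge $e$ of a finite weighted graph $G$ a real number $\kappa_e=\kappa_e(G)$. No specific type is singled out (examples are the Ricci curvatures of Ollivier, Lin-Lu-Yau, Forman, Menger and Haantjes). Homogeneity: $\kappa$ is $\gamma$-homogeneous, for a real number $\gamma$, if for the scaled weighted graphs $G_a=(V,E,a\mathbf{w})$ with $a>0$ one has $\kappa_e(G_a)=a^\gamma\kappa_e(G_1)$ for all $e\in E$. Discrete piecewise-linear Ricci curvature flow with $A$-surgeries: put $t_0=0$, $w_e(t_0)=w_{0,e}$ and $c_{0,e}=\kappa_e(G_0)$ for $e\in E_0$. Inductively, for $k\geq1$: (a) For $e\in E_{k-1}$, $w_e(t_k)=w_e(t_{k-1})\exp(-c_{k-1,e}(t_k-t_{k-1}))$. (b) ($A$-surgery at $t_k$) Set $$E_{k-1,A}=\left\{e\in E_{k-1}:\frac{w_e(t_k)}{\min_{e'\in E_{k-1}^e}w_{e'}(t_k)}\geq A\right\},$$ where $E_{k-1}^e$ is the set of edges of the connected component of $(V,E_{k-1})$ containing $e$. Put $E_k=E_{k-1}\setminus E_{k-1,A}$ and $G_k=(V,E_k,\mathbf{w}(t_k))$, with $\mathbf{w}(t_k)$ giving the weights $w_e(t_k)$, $e\in E_k$. (c) For $e\in E_k$, $c_{k,e}=c_{k-1,e}$ if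 $E_{k-1,A}=\varnothing$, and $c_{k,e}=\kappa_e(G_k)$ if $E_{k-1,A}\neq\varnothing$. In $G(t_k)=(V,E_{\ell-1},\mathbf{w}(t_k))$, the edge $e\in E_{\ell-1}$ carries the weight $w_e(t_k)$, and $\kappa_e(t_k)$ denotes the Ricci curvature of $e$ in $G(t_k)$.
   Formalization: Part 2 additionally assumes that the Ricci curvature of an edge does not change when edge weights outside its connected component change; for an arbitrary homogeneous κ part 2 fails, since different components are rescaled by different factors under the flow. *)

theory Defs
  imports Complex_Main "HOL-Library.FuncSet"
begin

text \<open>
  Finite undirected weighted graphs, with edges as abstract objects: \<open>ends G e\<close> is the set of
  end points of \<open>e\<close>. Loops and parallel edges are permitted; simple graphs are the case in which
  edges are two-element sets and \<open>ends\<close> is the identity on them.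
  The maps \<open>ends\<close> and \<open>weight\<close> are required to be \<^term>\<open>undefined\<close> off the edge set,
  so that a function of the graph cannot see weights of absent edges.
\<close>

record ('v, 'e) wgraph =
  verts :: "'v set"
  edges :: "'e set"
  ends :: "'e \<Rightarrow> 'v set"
  weight :: "'e \<Rightarrow> real"

definition finite_weighted_graph :: "('v, 'e) wgraph \<Rightarrow> bool" where
  "finite_weighted_graph G \<longleftrightarrow>
     finite (verts G) \<and> finite (edges G) \<and>
     (\<forall>e\<in>edges G. ends G e \<subseteq> verts G \<and> card (ends G e) \<in> {1, 2}) \<and>
     (\<forall>e\<in>edges G. 0 < weight G e) \<and>
     ends G \<in> extensional (edges G) \<and> weight G \<in> extensional (edges G)"

definition sub_wgraph ::
  "('v, 'e) wgraph \<Rightarrow> 'v set \<Rightarrow> 'e set \<Rightarrow> ('e \<Rightarrow> real) \<Rightarrow> ('v, 'e) wgraph" where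
  "sub_wgraph G V E w =
     \<lparr>verts = V, edges = E, ends = restrict (ends G) E, weight = restrict w E\<rparr>"

definition scale_weights :: "real \<Rightarrow> ('v, 'e) wgraph \<Rightarrow> ('v, 'e) wgraph" where
  "scale_weights a G = G\<lparr>weight := restrict (\<lambda>e. a * weight G e) (edges G)\<rparr>"

definition adjacency :: "('v, 'e) wgraph \<Rightarrow> ('v \<times> 'v) set" where
  "adjacency G = {(u, v). \<exists>e\<in>edges G. u \<in> ends G e \<and> v \<in> ends G e}"

definition reachable_verts :: "('v, 'e) wgraph \<Rightarrow> 'v \<Rightarrow> 'v set" where
  "reachable_verts G u = {v \<in> verts G. (u, v) \<in> (adjacency G)\<^sup>*}"

definition components :: "('v, 'e) wgraph \<Rightarrow> ('v, 'e) wgraph set" where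
  "components G =
     {sub_wgraph G V {e \<in> edges G. ends G e \<subseteq> V} (weight G) | V.
        \<exists>u\<in>verts G. V = reachable_verts G u}"

definition component_edges :: "('v, 'e) wgraph \<Rightarrow> 'e \<Rightarrow> 'e set" where
  "component_edges G e = {e'. \<exists>C\<in>components G. e \<in> edges C \<and> e' \<in> edges C}"

definition weight_ratio :: "('v, 'e) wgraph \<Rightarrow> 'e \<Rightarrow> real" where
  "weight_ratio G e = weight G e / Min (weight G ` component_edges G e)"

definition surgery_edges :: "real \<Rightarrow> ('v, 'e) wgraph \<Rightarrow> 'e set" where
  "surgery_edges A G = {e \<in> edges G. weight_ratio G e \<ge> A}"

type_synonym ('v, 'e) curvature = "('v, 'e) wgraph \<Rightarrow> 'e \<Rightarrow> real"

definition homogeneous :: "real \<Rightarrow> ('v, 'e) curvature \<Rightarrow> bool" where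
  "homogeneous \<gamma> \<kappa> \<longleftrightarrow>
     (\<forall>G a. finite_weighted_graph G \<longrightarrow> a > 0 \<longrightarrow>
        (\<forall>e\<in>edges G. \<kappa> (scale_weights a G) e = a powr \<gamma> * \<kappa> G e))"

text \<open>
  The curvature of an edge is unaffected by changing weights outside the connected component of
  that edge. The Ricci curvatures of Ollivier, Lin--Lu--Yau, Forman, Menger and Haantjes all have
  this property. It does not follow from homogeneity, which only rescales all components by a
  common factor, whereas under the flow each component is rescaled by its own factor.
\<close>

definition component_local :: "('v, 'e) curvature \<Rightarrow> bool" where
  "component_local \<kappa> \<longleftrightarrow>
     (\<forall>G w e. finite_weighted_graph G \<longrightarrow> finite_weighted_graph (G\<lparr>weight := w\<rparr>) \<longrightarrow>
        e \<in> edges G \<longrightarrow> (\<forall>e'\<in>component_edges G e. w e' = weight G e') \<longrightarrow>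
        \<kappa> (G\<lparr>weight := w\<rparr>) e = \<kappa> G e)"

text \<open>
  The discrete piecewise-linear flow with \<open>A\<close>-surgeries: \<open>E k\<close> is the edge set after the surgery
  at time \<open>t k\<close>, \<open>w k e\<close> the weight of \<open>e\<close> at time \<open>t k\<close> (meaningful for \<open>e \<in> E (k - 1)\<close>),
  and \<open>c k e\<close> the rate used on the interval from \<open>t k\<close> to \<open>t (k + 1)\<close> (meaningful for
  \<open>e \<in> E k\<close>). Nothing is said about \<open>w\<close> and \<open>c\<close> elsewhere.
\<close>

definition ricci_flow_with_surgeries ::
  "('v, 'e) curvature \<Rightarrow> real \<Rightarrow> (nat \<Rightarrow> real) \<Rightarrow> ('v, 'e) wgraph \<Rightarrow>
   (nat \<Rightarrow> 'e set) \<Rightarrow> (nat \<Rightarrow> 'e \<Rightarrow> real) \<Rightarrow> (nat \<Rightarrow> 'e \<Rightarrow> real) \<Rightarrow> bool" where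
  "ricci_flow_with_surgeries \<kappa> A t G0 E w c \<longleftrightarrow>
     t 0 = 0 \<and> E 0 = edges G0 \<and>
     (\<forall>e\<in>E 0. w 0 e = weight G0 e \<and> c 0 e = \<kappa> G0 e) \<and>
     (\<forall>k\<ge>1.
        (\<forall>e\<in>E (k - 1). w k e = w (k - 1) e * exp (- c (k - 1) e * (t k - t (k - 1)))) \<and>
        (let S = surgery_edges A (sub_wgraph G0 (verts G0) (E (k - 1)) (w k));
             Gk = sub_wgraph G0 (verts G0) (E k) (w k)
         in E k = E (k - 1) - S \<and>
            (\<forall>e\<in>E k. c k e = (if S = {} then c (k - 1) e else \<kappa> Gk e))))"

end

theory Submission
  imports Defs
begin

text \<open>
  Edge sets only shrink, so there is a last surgery time \<open>t N\<close> (or \<open>N = 0\<close>); from then on every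
  weight is an exponential with a fixed rate \<open>c N e = \<kappa> G\<^sub>N e\<close>. As no surgery takes
  place after \<open>t N\<close>, weight ratios inside a component stay below \<open>A\<close> for ever, which is possible only
  if all rates in the component agree. Hence each component is merely rescaled, and locality together
  with homogeneity turns the common rate into a common curvature.
\<close>

lemma finite_weighted_graph_sub_wgraph:
  assumes "finite_weighted_graph G" "E \<subseteq> edges G" "\<forall>e\<in>E. 0 < w e"
  shows "finite_weighted_graph (sub_wgraph G (verts G) E w)"
  using assms by (auto simp: finite_weighted_graph_def sub_wgraph_def intro: finite_subset)

text \<open>The extensionality built into \<open>finite_weighted_graph\<close> makes this an
  equality of records. It serves a flow without any surgery, whose rates are curvatures of the
  initial graph itself.\<close>

lemma sub_wgraph_self:
  assumes "finite_weighted_graph G" "\<forall>e\<in>edges G. w e = weight G e"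
  shows "sub_wgraph G (verts G) (edges G) w = G"
proof -
  have "restrict w (edges G) = restrict (weight G) (edges G)"
    using assms(2) by (auto simp: restrict_def)
  then show ?thesis
    using assms(1) by (simp add: sub_wgraph_def finite_weighted_graph_def extensional_restrict)
qed

text \<open>Indexing by vertices turns quantification over components into bounded quantification
  over \<open>verts G\<close>, which survives a change of weights.\<close>

lemma components_image:
  "components G = (\<lambda>u. sub_wgraph G (reachable_verts G u)
     {e \<in> edges G. ends G e \<subseteq> reachable_verts G u} (weight G)) ` verts G"
  by (auto simp: components_def)

text \<open>Adjacency reads only edges and end points. Components as records may change with the
  weights, so invariance is stated for their edge sets.\<close>

lemma component_edges_weight_update [simp]:
  "component_edges (G\<lparr>weight := w\<rparr>) e = component_edges G e"
proof -
  have "reachable_verts (G\<lparr>weight := w\<rparr>) = reachable_verts G"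
    by (simp add: reachable_verts_def adjacency_def fun_eq_iff)
  then show ?thesis
    by (simp add: component_edges_def components_image sub_wgraph_def)
qed

lemma component_edges_sub_wgraph_cong:
  "component_edges (sub_wgraph G V E w) e = component_edges (sub_wgraph G V E w') e"
proof -
  have "sub_wgraph G V E w = (sub_wgraph G V E w')\<lparr>weight := restrict w E\<rparr>"
    by (simp add: sub_wgraph_def)
  then show ?thesis by simp
qed

lemma component_edgesD: "e' \<in> component_edges G e \<Longrightarrow> e \<in> edges G \<and> e' \<in> edges G"
  by (auto simp: component_edges_def components_def sub_wgraph_def)

lemma component_edges_subset: "component_edges G e \<subseteq> edges G"
  by (auto dest: component_edgesD)

lemma edges_component_subset: "C \<in> components G \<Longrightarrow> edges C \<subseteq> edges G"
  by (auto simp: components_def sub_wgraph_def)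

lemma component_edges_commute: "e' \<in> component_edges G e \<longleftrightarrow> e \<in> component_edges G e'"
  by (auto simp: component_edges_def)

text \<open>The ratio test fails at \<open>e\<close>, so its weight is below \<open>A\<close> times
  the component minimum, which is at most the weight of \<open>e'\<close>. Positivity of
  \<open>A\<close> comes from a positive ratio lying below it.\<close>

lemma weight_less_of_no_surgery:
  assumes G: "finite_weighted_graph G" and "surgery_edges A G = {}"
    and e: "e' \<in> component_edges G e"
  shows "weight G e < A * weight G e'"
proof -
  have "e \<in> edges G" "e' \<in> edges G"
    using component_edgesD[OF e] by auto
  let ?M = "Min (weight G ` component_edges G e)"
  have fin: "finite (weight G ` component_edges G e)"
    using G finite_subset[OF component_edges_subset, of G e] by (simp add: finite_weighted_graph_def)
  have "?M \<in> weight G ` component_edges G e"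
    using fin e by (intro Min_in) auto
  then have pos: "0 < ?M"
    using G component_edges_subset by (fastforce simp: finite_weighted_graph_def)
  have le: "?M \<le> weight G e'"
    using fin e by simp
  have less: "weight G e / ?M < A"
    using assms(2) \<open>e \<in> edges G\<close> by (fastforce simp: surgery_edges_def weight_ratio_def)
  have "0 < weight G e"
    using G \<open>e \<in> edges G\<close> by (simp add: finite_weighted_graph_def)
  then have "0 < A"
    using less pos by (smt (verit) divide_pos_pos)
  have "weight G e < A * ?M"
    using less pos by (simp add: pos_divide_less_eq)
  also have "\<dots> \<le> A * weight G e'"
    using le \<open>0 < A\<close> by simp
  finally show ?thesis .
qed

text \<open>If \<open>a < b\<close>, dividing the hypothesis by \<open>x * exp (- b * s k)\<close>
  would bound \<open>exp ((b - a) * s k)\<close> by \<open>A * y / x\<close>, although it tends to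
  infinity with \<open>s\<close>.\<close>

lemma rate_le_of_exp_bounded:
  fixes x y a b A :: real and s :: "nat \<Rightarrow> real"
  assumes "0 < x" "filterlim s at_top sequentially"
    and le: "\<And>k. k > N \<Longrightarrow> x * exp (- a * s k) < A * (y * exp (- b * s k))"
  shows "b \<le> a"
proof (rule ccontr)
  assume "\<not> b \<le> a"
  then have "filterlim (\<lambda>k. (b - a) * s k) at_top sequentially"
    using assms(2) by (intro filterlim_tendsto_pos_mult_at_top[OF tendsto_const]) auto
  then have "filterlim (\<lambda>k. exp ((b - a) * s k)) at_top sequentially"
    by (rule filterlim_compose[OF exp_at_top])
  then have "\<forall>\<^sub>F k in sequentially. A * y / x \<le> exp ((b - a) * s k)"
    by (simp add: filterlim_at_top)
  then have "\<forall>\<^sub>F k in sequentially. k > N \<and> A * y / x \<le> exp ((b - a) * s k)"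
    by (intro eventually_conj eventually_gt_at_top)
  then obtain k where k: "k > N" "A * y / x \<le> exp ((b - a) * s k)"
    using eventually_happens'[OF sequentially_bot] by blast
  have "exp ((b - a) * s k) * exp (- b * s k) = exp (- a * s k)"
    by (simp add: exp_add[symmetric] algebra_simps)
  moreover have "A * y \<le> x * exp ((b - a) * s k)"
    using k(2) assms(1) by (simp add: pos_divide_le_eq mult.commute)
  ultimately have "A * y * exp (- b * s k) \<le> x * exp (- a * s k)"
    by (metis mult.assoc mult_right_mono exp_ge_zero)
  then show False
    using le[OF k(1)] by simp
qed

text \<open>An index of least cardinality works: later sets are subsets with no fewer elements,
  hence equal.\<close>

lemma decreasing_finite_sets_stabilise:
  fixes E :: "nat \<Rightarrow> 'a set"
  assumes "finite (E 0)" "\<And>k. E (Suc k) \<subseteq> E k"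
  shows "\<exists>N. \<forall>k\<ge>N. E k = E N"
proof -
  have anti: "E k \<subseteq> E j" if "j \<le> k" for j k
    using assms(2) that by (rule lift_Suc_antimono_le)
  have fin: "finite (E k)" for k
    using anti[of 0 k] assms(1) finite_subset by blast
  obtain N where N: "\<And>k. card (E N) \<le> card (E k)"
    using ex_has_least_nat[of "\<lambda>_. True" 0 "\<lambda>k. card (E k)"] by auto
  show ?thesis
    using card_seteq[OF fin anti N] by blast
qed

text \<open>Homogeneity handles the scaling of all of \<open>G\<close> by \<open>a\<close>; locality
  then replaces the scaled weights outside the component of \<open>e\<close> by those of
  \<open>w\<close>.\<close>

lemma curvature_of_rescaled_component:
  assumes "component_local \<kappa>" "homogeneous \<gamma> \<kappa>"
    and G: "finite_weighted_graph G" "finite_weighted_graph (G\<lparr>weight := w\<rparr>)"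
    and "0 < a" "e \<in> edges G"
    and w: "\<And>e'. e' \<in> component_edges G e \<Longrightarrow> w e' = a * weight G e'"
  shows "\<kappa> (G\<lparr>weight := w\<rparr>) e = a powr \<gamma> * \<kappa> G e"
proof -
  let ?H = "scale_weights a G"
  have fin: "finite_weighted_graph ?H"
    using G(1) \<open>0 < a\<close> by (simp add: finite_weighted_graph_def scale_weights_def)
  have ce: "component_edges ?H e = component_edges G e"
    by (simp add: scale_weights_def)
  have upd: "?H\<lparr>weight := w\<rparr> = G\<lparr>weight := w\<rparr>"
    by (simp add: scale_weights_def)
  have "w e' = weight ?H e'" if "e' \<in> component_edges G e" for e'
    using w[OF that] subsetD[OF component_edges_subset that] by (simp add: scale_weights_def)
  moreover have "e \<in> edges ?H"
    using \<open>e \<in> edges G\<close> by (simp add: scale_weights_def)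
  ultimately have "\<kappa> (?H\<lparr>weight := w\<rparr>) e = \<kappa> ?H e"
    using \<open>component_local \<kappa>\<close> fin G(2) ce upd unfolding component_local_def by metis
  then show ?thesis
    using assms(2) G(1) \<open>0 < a\<close> \<open>e \<in> edges G\<close> upd by (simp add: homogeneous_def)
qed

theorem theorem2p3:
  fixes \<kappa> :: "('v, 'e) curvature"
    and G0 :: "('v, 'e) wgraph"
    and A :: real
    and t :: "nat \<Rightarrow> real"
    and E :: "nat \<Rightarrow> 'e set"
    and w c :: "nat \<Rightarrow> 'e \<Rightarrow> real"
  assumes "finite_weighted_graph G0"
    and "A > 1"
    and "edges G0 \<noteq> {} \<longrightarrow> A > Max (weight_ratio G0 ` edges G0)"
    and "strict_mono_on {1..} t"
    and "\<forall>k\<ge>1. t k > 0"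
    and "filterlim t at_top sequentially"
    and "ricci_flow_with_surgeries \<kappa> A t G0 E w c"
  shows "\<exists>l\<ge>1. \<forall>k\<ge>l.
           E (k - 1) = E (l - 1) \<and>
           (let Gt = sub_wgraph G0 (verts G0) (E (l - 1)) (w k) in
            \<forall>G'\<in>components Gt.
              (\<forall>e\<in>edges G'. \<forall>e'\<in>edges G'. w k e / w k e' = w l e / w l e') \<and>
              (\<forall>\<gamma>. component_local \<kappa> \<longrightarrow> homogeneous \<gamma> \<kappa> \<longrightarrow>
                 (\<exists>\<Theta>. \<forall>e\<in>edges G'. \<kappa> Gt e = \<Theta>)))"
proof -

  \<comment> \<open>Recursion equations of the flow\<close>
  define V where "V = verts G0"
  define H where "H = (\<lambda>F. sub_wgraph G0 V F)"
  note G0 = assms(1) and flow = assms(7)[unfolded ricci_flow_with_surgeries_def Let_def]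
  have E0: "E 0 = edges G0" and
    init: "\<And>e. e \<in> E 0 \<Longrightarrow> w 0 e = weight G0 e \<and> c 0 e = \<kappa> G0 e"
    using flow by auto
  have w_Suc: "w (Suc k) e = w k e * exp (- c k e * (t (Suc k) - t k))" if "e \<in> E k" for k e
    using flow that by (auto dest: spec[of _ "Suc k"])
  have E_Suc: "E (Suc k) = E k - surgery_edges A (H (E k) (w (Suc k)))" for k
    using flow by (auto dest: spec[of _ "Suc k"] simp: H_def V_def)
  have c_Suc: "c (Suc k) e = (if surgery_edges A (H (E k) (w (Suc k))) = {} then c k e
      else \<kappa> (H (E (Suc k)) (w (Suc k))) e)" if "e \<in> E (Suc k)" for k e
    using flow that by (auto dest: spec[of _ "Suc k"] simp: H_def V_def)
  have edges_H [simp]: "edges (H F u) = F" for F u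
    by (simp add: H_def sub_wgraph_def)
  have weight_H: "weight (H F u) = restrict u F" for F u
    by (simp add: H_def sub_wgraph_def)
  \<comment> \<open>Graphs on the same edge set differ by a weight update, the form in which
    locality is stated.\<close>
  have H_upd: "H F u = (H F u')\<lparr>weight := restrict u F\<rparr>" for F u u'
    by (simp add: H_def sub_wgraph_def)
  have ce_H: "component_edges (H F u) e = component_edges (H F u') e" for F u u' e
    unfolding H_def by (rule component_edges_sub_wgraph_cong)
  have surgery_subset: "surgery_edges A (H F u) \<subseteq> F" for F u
    by (auto simp: surgery_edges_def)
  have E_dec: "E (Suc k) \<subseteq> E k" for k
    using E_Suc by blast
  have sub: "E k \<subseteq> edges G0" for k
    using lift_Suc_antimono_le[of E 0 k] E_dec E0 by auto
  have w_pos: "0 < w k e" if "e \<in> E k" for k e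
    using that
  proof (induction k)
    case 0
    then show ?case
      using init E0 G0 by (auto simp: finite_weighted_graph_def)
  next
    case (Suc k)
    then have "e \<in> E k"
      using E_dec by auto
    then show ?case
      using w_Suc Suc.IH by simp
  qed

  \<comment> \<open>The last surgery and the weights after it\<close>
  have "\<exists>N. \<forall>k\<ge>N. E k = E N"
    using G0 E0 E_dec
    by (intro decreasing_finite_sets_stabilise) (auto simp: finite_weighted_graph_def)
  \<comment> \<open>Minimality of \<open>N\<close> ensures that, unless \<open>N = 0\<close>, edges
    are really removed at \<open>t N\<close>, so that the rates are recomputed there from the
    current graph.\<close>
  then obtain N where N: "\<And>k. k \<ge> N \<Longrightarrow> E k = E N"
    and least: "\<And>M. M < N \<Longrightarrow> \<not> (\<forall>k\<ge>M. E k = E M)"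
    using exists_least_iff[of "\<lambda>N. \<forall>k\<ge>N. E k = E N"] by blast
  define F where "F = E N"

  have c_N: "c N e = \<kappa> (H F (w N)) e" if "e \<in> F" for e
  proof (cases N)
    case 0
    then have "H F (w N) = G0"
      using sub_wgraph_self[OF G0, of "w 0"] init E0 by (auto simp: H_def V_def F_def)
    then show ?thesis
      using init that 0 by (simp add: F_def)
  next
    case (Suc M)
    have "E (Suc M) \<noteq> E M"
    proof
      assume eq: "E (Suc M) = E M"
      have "E k = E M" if "k \<ge> M" for k
        using that N[of k] eq Suc by (cases "k = M") auto
      then show False
        using least[of M] Suc by blast
    qed
    then have "surgery_edges A (H (E M) (w (Suc M))) \<noteq> {}"
      using E_Suc by auto
    then show ?thesis
      using c_Suc that Suc by (simp add: F_def)
  qed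
  \<comment> \<open>The surgery at \<open>t (Suc k)\<close> tests the edges of \<open>E k\<close>,
    so stability of \<open>E\<close> from \<open>N\<close> on gives empty surgeries only strictly
    after \<open>t N\<close>.\<close>
  have no_surgery: "surgery_edges A (H F (w (Suc k))) = {}" if "k \<ge> N" for k
    using E_Suc[of k] N[of k] N[of "Suc k"] that surgery_subset[of F "w (Suc k)"]
    by (auto simp: F_def)
  have c_const: "c k e = c N e" if "k \<ge> N" "e \<in> F" for k e
    using that(1)
  proof (induction k rule: dec_induct)
    case (step k)
    then show ?case
      using c_Suc[of e k] no_surgery[of k] N[of k] N[of "Suc k"] that(2) by (simp add: F_def)
  qed simp
  have w_exp: "w k e = w N e * exp (- c N e * (t k - t N))" if "k \<ge> N" "e \<in> F" for k e
    using that(1)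
  proof (induction k rule: dec_induct)
    case (step k)
    have "w (Suc k) e = w k e * exp (- c N e * (t (Suc k) - t k))"
      using w_Suc[of e k] N[of k] c_const[of k e] step that(2) by (simp add: F_def)
    also have "\<dots> = w N e * exp (- c N e * (t (Suc k) - t N))"
      by (simp add: step.IH exp_add[symmetric] algebra_simps)
    finally show ?case .
  qed simp
  have fin_H: "finite_weighted_graph (H F (w k))" if "k \<ge> N" for k
    using finite_weighted_graph_sub_wgraph[OF G0 sub, of k "w k"] w_pos N[OF that]
    by (auto simp: H_def V_def F_def)

  \<comment> \<open>Equality of rates within a component\<close>
  have lim: "filterlim (\<lambda>k. t k - t N) at_top sequentially"
    using filterlim_tendsto_add_at_top[OF tendsto_const assms(6), of "- t N"] by simp
  \<comment> \<open>The weights \<open>u\<close> are arbitrary: by \<open>ce_H\<close> membership in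
    a component carries over to the weights at every later time.\<close>
  have rate_le: "c N e' \<le> c N e" if "e' \<in> component_edges (H F u) e" for e e' u
  proof -
    have mem: "e \<in> F" "e' \<in> F"
      using component_edgesD[OF that] by auto
    show ?thesis
    proof (rule rate_le_of_exp_bounded[OF _ lim, of "w N e" N _ A "w N e'"])
      show "0 < w N e"
        using w_pos mem by (simp add: F_def)
      fix k assume k: "k > N"
      then obtain j where j: "k = Suc j" "j \<ge> N"
        by (cases k) auto
      have "e' \<in> component_edges (H F (w k)) e"
        using that ce_H[of F u e "w k"] by simp
      then have "w k e < A * w k e'"
        using weight_less_of_no_surgery[OF fin_H[of k], of A e' e] no_surgery[OF j(2)] j(1) k mem
        by (simp add: weight_H)
      then show "w N e * exp (- c N e * (t k - t N)) < A * (w N e' * exp (- c N e' * (t k - t N)))"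
        using w_exp[of k] k mem by simp
    qed
  qed
  \<comment> \<open>Lying in a common component is symmetric, so the inequality holds both
    ways.\<close>
  have rate_eq: "c N e' = c N e" if "e' \<in> component_edges (H F u) e" for e e' u
    using rate_le[OF that] rate_le[OF component_edges_commute[THEN iffD1, OF that]] by simp

  \<comment> \<open>Constant weight ratios and constant curvature\<close>
  show ?thesis
  \<comment> \<open>The graph at \<open>t k\<close> carries \<open>E (l - 1)\<close>, which must be
    the final edge set \<open>F\<close>; for \<open>N > 0\<close>, the choice \<open>l = N\<close>
    would keep the edges removed at \<open>t N\<close>.\<close>
  proof (intro exI[of _ "Suc N"] conjI allI impI)
    fix k assume k: "Suc N \<le> k"
    show "E (k - 1) = E (Suc N - 1)"
      using N[of "k - 1"] k by simp
    have "(\<forall>e\<in>edges G'. \<forall>e'\<in>edges G'. w k e / w k e' = w (Suc N) e / w (Suc N) e') \<and>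
        (\<forall>\<gamma>. component_local \<kappa> \<longrightarrow> homogeneous \<gamma> \<kappa> \<longrightarrow> (\<exists>\<Theta>. \<forall>e\<in>edges G'. \<kappa> (H F (w k)) e = \<Theta>))"
      if G': "G' \<in> components (H F (w k))" for G'
    proof (intro conjI ballI allI impI)
      have mem: "e \<in> F" if "e \<in> edges G'" for e
        using that edges_component_subset[OF G'] by auto
      have rates: "c N e' = c N e" if "e \<in> edges G'" "e' \<in> edges G'" for e e'
        using that G' by (intro rate_eq[of _ "w k"]) (auto simp: component_edges_def)
      show "w k e / w k e' = w (Suc N) e / w (Suc N) e'"
        if "e \<in> edges G'" "e' \<in> edges G'" for e e'
        using that mem rates[OF that] w_exp[of k] w_exp[of "Suc N"] k by simp
      fix \<gamma> assume \<kappa>: "component_local \<kappa>" "homogeneous \<gamma> \<kappa>"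
      \<comment> \<open>The comparison is with time \<open>t N\<close>, where rates are curvatures.
        The scale factor depends on the component, which is where locality enters.\<close>
      have curv: "\<kappa> (H F (w k)) e = exp (- c N e * (t k - t N)) powr \<gamma> * c N e"
        if e: "e \<in> edges G'" for e
      proof -
        let ?a = "exp (- c N e * (t k - t N))"
        have "restrict (w k) F e' = ?a * weight (H F (w N)) e'"
          if "e' \<in> component_edges (H F (w N)) e" for e'
          using subsetD[OF component_edges_subset that] rate_eq[OF that] w_exp[of k e'] k
          by (simp add: weight_H)
        then have "\<kappa> ((H F (w N))\<lparr>weight := restrict (w k) F\<rparr>) e = ?a powr \<gamma> * \<kappa> (H F (w N)) e"
          using fin_H[of k] fin_H[of N] k mem[OF e] H_upd[of F "w k" "w N"]
          by (intro curvature_of_rescaled_component[OF \<kappa>]) auto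
        then show ?thesis
          using c_N[OF mem[OF e]] H_upd[of F "w k" "w N"] by simp
      qed
      show "\<exists>\<Theta>. \<forall>e\<in>edges G'. \<kappa> (H F (w k)) e = \<Theta>"
      \<comment> \<open>An isolated vertex forms a component with no edge from which a rate can be
        read off.\<close>
      proof (cases "edges G' = {}")
        case False
        then obtain e0 where e0: "e0 \<in> edges G'"
          by blast
        show ?thesis
          using curv rates[OF e0] by (intro exI ballI) simp
      qed simp
    qed
    then show "let Gt = sub_wgraph G0 (verts G0) (E (Suc N - 1)) (w k) in
        \<forall>G'\<in>components Gt.
          (\<forall>e\<in>edges G'. \<forall>e'\<in>edges G'. w k e / w k e' = w (Suc N) e / w (Suc N) e') \<and>
          (\<forall>\<gamma>. component_local \<kappa> \<longrightarrow> homogeneous \<gamma> \<kappa> \<longrightarrow>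
             (\<exists>\<Theta>. \<forall>e\<in>edges G'. \<kappa> Gt e = \<Theta>))"
      by (simp add: H_def V_def F_def Let_def)
  qed simp
qed

end
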